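(* Let $Q$ be a finite connected quandle with elements $1,2,\dots,n$, and suppose that the elements of $Q$ are naturally ordered. Then every automorphism of $Q$, regarded as a bijection $\{1,\dots,n\}\to\{1,\dots,n\}$, is a natural reordering of $Q$ (with respect to $r_q$ for some $q\in Q$).
   Context: A quandle is a set $Q$ with a binary operation $*$ such that: (1) $a*a=a$ for all $a\in Q$; (2) for all $a,b\in Q$ there is a unique $c\in Q$ with $a=c*b$; (3) $(a*b)*c=(a*c)*(b*c)$ for all $a,b,c\in Q$. For $b\in Q$ let $r_b:Q\to Q$, $r_b(x)=x*b$ (a bijection), and write $a\,\bar{*}\,b=r_b^{-1}(a)$. An automorphism of $Q$ is a bijection $f:Q\to Q$ with $f(a*b)=f(a)*f(b)$ for all $a,b$. $Q$ is connected if for every $a\in Q$ the orbit $\{(\cdots((a\star_1 b_1)\star_2 b_2)\cdots\star_m b_m) : m\ge 0,\ b_i\in Q,\ \star_i\in\{*,\bar{*}\}\}$ equals $Q$. Let $Q$ be a finite connected quandle with underlying set $\{1,\dots,n\}$. In this case all the permutations $r_1,\dots,r_n$ are conjugate in the symmetric group, so they have the same cycle lengths. The cycle notation $(i_1\ i_2\ \cdots\ i_\ell)$ means $i_1\mapsto i_2\mapsto\cdots\mapsto i_\ell\mapsto i_1$; cycles of length $1$ are included in cycle decompositions. Natural reordering: a bijection $\nu:\{1,\dots,n\}\to\{1,\dots,n\}$ is a natural reordering with respect to $r_q$ ($q\in Q$) if for some presentation of $r_q$ as a product of disjoint cycles $r_q=(i_{11}\ i_{12}\cdots i_{1\ell_1})(i_{21}\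 i_{22}\cdots i_{2\ell_2})\cdots(i_{k1}\ i_{k2}\cdots i_{k\ell_k})(q)$ with $1\le\ell_1\le\ell_2\le\cdots\le\ell_k$, one has $\nu(q)=n$ and $\nu(i_{st})=\bigl(\sum_{j=1}^{s-1}\ell_j\bigr)+t$ for all $1\le s\le k$, $1\le t\le \ell_s$. A natural reordering is a bijection that is a natural reordering with respect to $r_q$ for some $q\in Q$. The elements of $Q$ are naturally ordered if, for some $1\le\ell_1\le\cdots\le\ell_k$, $r_n=(1\ 2\cdots \ell_1)(\ell_1+1\ \cdots\ \ell_1+\ell_2)\cdots\bigl(\sum_{j=1}^{k-1}\ell_j+1\ \cdots\ \sum_{j=1}^{k-1}\ell_j+\ell_k\bigr)(n)$. *)

theory Defs
  imports Main "HOL-Combinatorics.Cycles"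
begin

text \<open>
  Quandles are given by an explicit carrier set and an operation on the ambient type; the values of
  the operation (and of automorphisms) outside the carrier are irrelevant.
\<close>

definition quandle :: "'a set \<Rightarrow> ('a \<Rightarrow> 'a \<Rightarrow> 'a) \<Rightarrow> bool" where
  "quandle Q star \<longleftrightarrow>
     (\<forall>a\<in>Q. \<forall>b\<in>Q. star a b \<in> Q) \<and>
     (\<forall>a\<in>Q. star a a = a) \<and>
     (\<forall>a\<in>Q. \<forall>b\<in>Q. \<exists>!c. c \<in> Q \<and> a = star c b) \<and>
     (\<forall>a\<in>Q. \<forall>b\<in>Q. \<forall>c\<in>Q. star (star a b) c = star (star a c) (star b c))"

definition right_mult :: "('a \<Rightarrow> 'a \<Rightarrow> 'a) \<Rightarrow> 'a \<Rightarrow> 'a \<Rightarrow> 'a" where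
  "right_mult star b = (\<lambda>x. star x b)"

definition bar_star :: "'a set \<Rightarrow> ('a \<Rightarrow> 'a \<Rightarrow> 'a) \<Rightarrow> 'a \<Rightarrow> 'a \<Rightarrow> 'a" where
  "bar_star Q star a b = inv_into Q (right_mult star b) a"

definition quandle_automorphism :: "'a set \<Rightarrow> ('a \<Rightarrow> 'a \<Rightarrow> 'a) \<Rightarrow> ('a \<Rightarrow> 'a) \<Rightarrow> bool" where
  "quandle_automorphism Q star f \<longleftrightarrow>
     bij_betw f Q Q \<and> (\<forall>a\<in>Q. \<forall>b\<in>Q. f (star a b) = star (f a) (f b))"

text \<open>
  A word is a list of pairs \<open>(b\<^sub>i, e\<^sub>i)\<close>; the flag \<open>e\<^sub>i\<close> selects the operation \<open>star\<close> (True) or its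
  inverse \<open>bar_star\<close> (False) by which \<open>b\<^sub>i\<close> acts.
\<close>

definition act_word :: "'a set \<Rightarrow> ('a \<Rightarrow> 'a \<Rightarrow> 'a) \<Rightarrow> 'a \<Rightarrow> ('a \<times> bool) list \<Rightarrow> 'a" where
  "act_word Q star a w =
     foldl (\<lambda>x (b, e). if e then star x b else bar_star Q star x b) a w"

definition quandle_orbit :: "'a set \<Rightarrow> ('a \<Rightarrow> 'a \<Rightarrow> 'a) \<Rightarrow> 'a \<Rightarrow> 'a set" where
  "quandle_orbit Q star a = {act_word Q star a w |w. set w \<subseteq> Q \<times> UNIV}"

definition connected_quandle :: "'a set \<Rightarrow> ('a \<Rightarrow> 'a \<Rightarrow> 'a) \<Rightarrow> bool" where
  "connected_quandle Q star \<longleftrightarrow>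
     quandle Q star \<and> (\<forall>a\<in>Q. quandle_orbit Q star a = Q)"

definition cycle_product :: "'a list list \<Rightarrow> 'a \<Rightarrow> 'a" where
  "cycle_product css = foldr (\<lambda>cs p. cycle_of_list cs \<circ> p) css id"

text \<open>
  A presentation of \<open>r\<close>, restricted to \<open>Q\<close>, as a product of disjoint nonempty cycles. Cycles of
  length 1 are listed, so every element of \<open>Q\<close> occurs exactly once.
\<close>

definition cycle_presentation :: "'a set \<Rightarrow> ('a \<Rightarrow> 'a) \<Rightarrow> 'a list list \<Rightarrow> bool" where
  "cycle_presentation Q r css \<longleftrightarrow>
     (\<forall>cs\<in>set css. cs \<noteq> []) \<and>
     distinct (concat css) \<and> set (concat css) = Q \<and>
     (\<forall>x\<in>Q. r x = cycle_product css x)"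

text \<open>
  Lists are indexed from 0: the entry \<open>i\<^sub>s\<^sub>t\<close> with \<open>1 \<le> s\<close> and \<open>1 \<le> t\<close> is \<open>css ! (s - 1) ! (t - 1)\<close>,
  which accounts for the summand \<open>t + 1\<close>.
\<close>

definition natural_reordering_wrt ::
    "nat \<Rightarrow> (nat \<Rightarrow> nat \<Rightarrow> nat) \<Rightarrow> nat \<Rightarrow> (nat \<Rightarrow> nat) \<Rightarrow> bool" where
  "natural_reordering_wrt n star q \<nu> \<longleftrightarrow>
     bij_betw \<nu> {1..n} {1..n} \<and>
     (\<exists>css. cycle_presentation {1..n} (right_mult star q) (css @ [[q]]) \<and>
        sorted (map length css) \<and>
        \<nu> q = n \<and>
        (\<forall>s<length css. \<forall>t<length (css ! s).
           \<nu> (css ! s ! t) = (\<Sum>j<s. length (css ! j)) + (t + 1)))"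

definition natural_reordering :: "nat \<Rightarrow> (nat \<Rightarrow> nat \<Rightarrow> nat) \<Rightarrow> (nat \<Rightarrow> nat) \<Rightarrow> bool" where
  "natural_reordering n star \<nu> \<longleftrightarrow> (\<exists>q\<in>{1..n}. natural_reordering_wrt n star q \<nu>)"

text \<open>The cycles of consecutive integers \<open>(1 2 \<dots> l\<^sub>1) (l\<^sub>1+1 \<dots> l\<^sub>1+l\<^sub>2) \<dots>\<close> for the list of lengths \<open>ls\<close>.\<close>

definition consecutive_cycles :: "nat list \<Rightarrow> nat list list" where
  "consecutive_cycles ls =
     map (\<lambda>s. [(\<Sum>j<s. ls ! j) + 1 ..< (\<Sum>j<s. ls ! j) + ls ! s + 1]) [0..<length ls]"

definition naturally_ordered :: "nat \<Rightarrow> (nat \<Rightarrow> nat \<Rightarrow> nat) \<Rightarrow> bool" where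
  "naturally_ordered n star \<longleftrightarrow>
     (\<exists>ls. (\<forall>l\<in>set ls. 1 \<le> l) \<and> sorted ls \<and>
        cycle_presentation {1..n} (right_mult star n) (consecutive_cycles ls @ [[n]]))"

end

theory Submission
  imports Defs
begin

text \<open>
  If \<open>f\<close> is an automorphism with inverse \<open>g\<close> and \<open>q = g n\<close>, then \<open>g\<close> conjugates \<open>r\<^sub>n\<close> into \<open>r\<^sub>q\<close>.
  Relabelling by \<open>g\<close> the cycles of consecutive integers that make up \<open>r\<^sub>n\<close> therefore presents \<open>r\<^sub>q\<close>,
  with the same cycle lengths, and \<open>f\<close> sends the entries of this presentation back to \<open>1, 2, \<dots>, n\<close>.
\<close>

text \<open>A cycle is a composition of transpositions, and an injection carries the transposition
  of \<open>i\<close> and \<open>j\<close> to that of \<open>g i\<close> and \<open>g j\<close>. The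
  membership in \<open>A\<close> is carried through the induction so that injectivity applies to
  intermediate values.\<close>

lemma cycle_of_list_map:
  assumes "inj_on g A" "set cs \<subseteq> A" "x \<in> A"
  shows "cycle_of_list (map g cs) (g x) = g (cycle_of_list cs x) \<and> cycle_of_list cs x \<in> A"
  using assms(2)
proof (induction cs rule: cycle_of_list.induct)
  case (1 i j cs)
  then have IH: "cycle_of_list (map g (j # cs)) (g x) = g (cycle_of_list (j # cs) x)"
    "cycle_of_list (j # cs) x \<in> A"
    by auto
  show ?case
    using 1 IH assms(1) by (auto simp: transpose_def inj_on_eq_iff)
qed (use assms(3) in auto)

lemma cycle_product_map:
  assumes "inj_on g A" "set (concat css) \<subseteq> A" "x \<in> A"
  shows "cycle_product (map (map g) css) (g x) = g (cycle_product css x)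
    \<and> cycle_product css x \<in> A"
  using assms(2)
proof (induction css)
  case (Cons cs css)
  then show ?case
    using cycle_of_list_map[OF assms(1), of cs "cycle_product css x"]
    by (auto simp: cycle_product_def)
qed (use assms(3) in \<open>simp add: cycle_product_def\<close>)

text \<open>Conjugating a permutation relabels its cycles. Since \<open>g\<close> is injective on
  \<open>A\<close>, the relabelled cycles stay disjoint.\<close>

lemma cycle_presentation_map:
  assumes g: "bij_betw g A B" and conj: "\<And>x. x \<in> A \<Longrightarrow> r' (g x) = g (r x)"
    and css: "cycle_presentation A r css"
  shows "cycle_presentation B r' (map (map g) css)"
proof -
  have inj: "inj_on g A" and im: "g ` A = B"
    using g by (auto simp: bij_betw_def)
  have set: "set (concat css) = A" and dist: "distinct (concat css)"
    using css by (auto simp: cycle_presentation_def)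
  have concat: "concat (map (map g) css) = map g (concat css)"
    by (simp add: map_concat)
  have "r' y = cycle_product (map (map g) css) y" if y: "y \<in> B" for y
  proof -
    obtain x where x: "x \<in> A" "y = g x"
      using y im by blast
    then show ?thesis
      using conj css cycle_product_map[OF inj _ x(1), of css] set
      by (simp add: cycle_presentation_def)
  qed
  then show ?thesis
    using css inj dist set im
    unfolding cycle_presentation_def concat set_map distinct_map by auto
qed

theorem theorem1p4:
  fixes n :: nat and star :: "nat \<Rightarrow> nat \<Rightarrow> nat" and f :: "nat \<Rightarrow> nat"
  assumes "quandle {1..n} star"
    and "connected_quandle {1..n} star"
    and "naturally_ordered n star"
    and "quandle_automorphism {1..n} star f"
  shows "natural_reordering n star f"
proof -
  let ?Q = "{1..n}"
  obtain ls where ls: "sorted ls"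
    "cycle_presentation ?Q (right_mult star n) (consecutive_cycles ls @ [[n]])"
    using assms(3) by (auto simp: naturally_ordered_def)
  define cc where "cc = consecutive_cycles ls"
  have setQ: "set (concat cc) \<union> {n} = ?Q"
    using ls(2) by (auto simp: cycle_presentation_def cc_def)
  then have n: "n \<in> ?Q"
    by blast
  have len: "map length cc = ls"
    by (rule nth_equalityI) (auto simp: cc_def consecutive_cycles_def)
  have f: "bij_betw f ?Q ?Q"
    and hom: "\<And>a b. a \<in> ?Q \<Longrightarrow> b \<in> ?Q \<Longrightarrow> f (star a b) = star (f a) (f b)"
    using assms(4) by (auto simp: quandle_automorphism_def)
  define g where "g = inv_into ?Q f"
  have g: "bij_betw g ?Q ?Q"
    unfolding g_def by (rule bij_betw_inv_into[OF f])
  have gQ: "g x \<in> ?Q" and fg: "f (g x) = x" if "x \<in> ?Q" for x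
    using that bij_betwE[OF g] bij_betw_inv_into_right[OF f] by (auto simp: g_def)
  have closed: "star a b \<in> ?Q" if "a \<in> ?Q" "b \<in> ?Q" for a b
    using assms(1)[unfolded quandle_def, THEN conjunct1] that by blast
  have conj: "right_mult star (g n) (g x) = g (right_mult star n x)" if x: "x \<in> ?Q" for x
  proof -
    \<comment> \<open>The homomorphism law is known for \<open>f\<close> only, so both sides are
      compared after applying \<open>f\<close>. Closedness then lets \<open>g\<close> cancel
      \<open>f\<close>, as \<open>g\<close> inverts it only on \<open>?Q\<close>.\<close>
    have "f (star (g x) (g n)) = star x n"
      using hom[OF gQ[OF x] gQ[OF n]] fg[OF x] fg[OF n] by simp
    then show ?thesis
      using bij_betw_inv_into_left[OF f closed[OF gQ[OF x] gQ[OF n]]]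
      by (simp add: right_mult_def g_def)
  qed
  define css where "css = map (map g) cc"
  \<comment> \<open>Relabelling turns the closing cycle \<open>[n]\<close> into
    \<open>[g n]\<close>, which is the shape required for \<open>q = g n\<close>.\<close>
  have pres: "cycle_presentation ?Q (right_mult star (g n)) (css @ [[g n]])"
    using cycle_presentation_map[where r' = "right_mult star (g n)", OF g conj ls(2)] by (simp add: css_def cc_def)
  have len': "map length css = ls"
    using len by (simp add: css_def comp_def)
  have lenj: "length (css ! j) = ls ! j" if "j < length css" for j
    using that len' by (metis nth_map)
  have "f (css ! s ! t) = (\<Sum>j<s. length (css ! j)) + (t + 1)"
    if s: "s < length css" and t: "t < length (css ! s)" for s t
  proof -
    have s': "s < length ls"
      using s unfolding len'[symmetric] by simp
    have t': "t < ls ! s"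
      using t lenj[OF s] by simp
    have scc: "s < length cc" and tcc: "t < length (cc ! s)"
      using s t by (auto simp: css_def)
    have "cc ! s ! t \<in> set (concat cc)"
      unfolding set_concat using nth_mem[OF scc] nth_mem[OF tcc] by blast
    then have "cc ! s ! t \<in> ?Q"
      using setQ by blast
    then have "f (css ! s ! t) = cc ! s ! t"
      using fg scc tcc by (simp add: css_def)
    \<comment> \<open>Block \<open>s\<close> starts at one more than the sum of the earlier lengths,
      and \<open>t\<close> counts from 0. Without \<open>upt_Suc\<close> the interval stays intact
      and can be indexed directly.\<close>
    also have "\<dots> = (\<Sum>j<s. ls ! j) + (t + 1)"
      using s' t' by (simp add: cc_def consecutive_cycles_def del: upt_Suc)
    also have "(\<Sum>j<s. ls ! j) = (\<Sum>j<s. length (css ! j))"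
      using s lenj by (intro sum.cong) auto
    finally show ?thesis .
  qed
  then have "natural_reordering_wrt n star (g n) f"
    unfolding natural_reordering_wrt_def
    using f pres len' ls(1) fg[OF n] by blast
  then show ?thesis
    using gQ[OF n] by (auto simp: natural_reordering_def)
qed

end
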